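(* Let $X$ be a Banach space, and let $S,T\in L(X)$ be two EP operators such that the Moore-Penrose inverse of $ST$ exists. (i) If $N(ST)=N(S)+N(T)$ and $R(ST)=R(S)\cap R(T)$, then $ST$ is EP. (ii) If $ST$ is EP, then $R(ST)\subseteq R(T)$ and $N(S)\subseteq N(ST)$. (iii) $R(ST)\subseteq R(T)$ if and only if $(I-TT^{\dagger})ST=0$; and $N(S)\subseteq N(ST)$ if and only if $ST(I-S^{\dagger}S)=0$. (iv) If $(I-T^{\dagger}T)ST=0$, $ST(I-S^{\dagger}S)=0$, and $S$ and $T$ are Fredholm operators, then $N(ST)=N(S)+N(T)$ and $R(ST)=R(S)\cap R(T)$. In particular, $ST$ is EP.
   Context: Scalars are complex. For a Banach space $X$, $L(X)$ is the Banach algebra of bounded linear operators on $X$ with the operator norm, $I$ is the identity; $N(T)$ and $R(T)$ are the null space and range of $T$. An operator $H\in L(X)$ is hermitian if $\|\exp(itH)\|=1$ for all $t\in\mathbb{R}$. The Moore-Penrose inverse of $T\in L(X)$, denoted $T^{\dagger}$, is the (at most one) $S\in L(X)$ with $T=TST$, $S=STS$, and $TS$ and $ST$ hermitian. An operator $T$ is EP if $T^{\dagger}$ exists and $TT^{\dagger}=T^{\dagger}T$. An operator is Fredholm if its range is closed, its null space is finite dimensional and its range has finite codimension. *)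

theory Defs
  imports "HOL-Analysis.Analysis"
begin

class complex_banach = banach +
  fixes scaleC :: "complex \<Rightarrow> 'a \<Rightarrow> 'a"  (infixr "*\<^sub>C" 75)
  assumes scaleC_add_right: "c *\<^sub>C (x + y) = c *\<^sub>C x + c *\<^sub>C y"
    and scaleC_add_left: "(c + d) *\<^sub>C x = c *\<^sub>C x + d *\<^sub>C x"
    and scaleC_scaleC: "c *\<^sub>C (d *\<^sub>C x) = (c * d) *\<^sub>C x"
    and scaleC_of_real: "complex_of_real r *\<^sub>C x = r *\<^sub>R x"
    and norm_scaleC: "norm (c *\<^sub>C x) = cmod c * norm x"

lemma scaleC_one: "1 *\<^sub>C (x :: 'a::complex_banach) = x"
  using scaleC_of_real[of 1 x] by simp

interpretation complex_vector: vector_space "scaleC :: complex \<Rightarrow> 'a \<Rightarrow> 'a::complex_banach"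
  by unfold_locales (simp_all add: scaleC_add_right scaleC_add_left scaleC_scaleC scaleC_one)

lemma bounded_linear_scaleC: "bounded_linear (scaleC c :: 'a \<Rightarrow> 'a::complex_banach)"
proof (rule bounded_linear_intro)
  show "c *\<^sub>C (x + y) = c *\<^sub>C x + c *\<^sub>C y" for x y :: 'a
    by (rule scaleC_add_right)
  show "c *\<^sub>C (r *\<^sub>R x) = r *\<^sub>R (c *\<^sub>C x)" for r and x :: 'a
    by (simp add: scaleC_scaleC mult.commute flip: scaleC_of_real)
  show "norm (c *\<^sub>C x) \<le> norm x * cmod c" for x :: 'a
    by (simp add: norm_scaleC)
qed


section \<open>The Banach algebra of bounded complex-linear operators\<close>

text \<open>The library type of bounded real-linear maps carries the operator norm; \<open>L(X)\<close> is
  its norm-closed subalgebra of complex-linear maps. It is not made an instance of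
  \<^class>\<open>ring_1\<close>, because \<open>0 = 1\<close> when the underlying space is zero.\<close>

typedef (overloaded) 'a operator =
  "{f :: 'a::complex_banach \<Rightarrow>\<^sub>L 'a. \<forall>c x. f (c *\<^sub>C x) = c *\<^sub>C f x}"
  morphisms blinfun_of_operator Abs_operator
  by (intro exI[of _ 0]) simp

setup_lifting type_definition_operator

lift_definition app :: "'a::complex_banach operator \<Rightarrow> 'a \<Rightarrow> 'a" is blinfun_apply .

lemma operator_eqI: "(\<And>x. app A x = app B x) \<Longrightarrow> A = B"
  by transfer (auto intro: blinfun_eqI)

instantiation operator :: (complex_banach) real_normed_vector
begin

lift_definition zero_operator :: "'a operator" is 0 by simp
lift_definition plus_operator :: "'a operator \<Rightarrow> 'a operator \<Rightarrow> 'a operator" is "(+)"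
  by (simp add: blinfun.add_left scaleC_add_right)
lift_definition minus_operator :: "'a operator \<Rightarrow> 'a operator \<Rightarrow> 'a operator" is "(-)"
  by (simp add: blinfun.diff_left complex_vector.scale_right_diff_distrib)
lift_definition uminus_operator :: "'a operator \<Rightarrow> 'a operator" is uminus
  by (simp add: blinfun.minus_left)
lift_definition scaleR_operator :: "real \<Rightarrow> 'a operator \<Rightarrow> 'a operator" is scaleR
  by (simp add: blinfun.scaleR_left scaleC_scaleC mult.commute flip: scaleC_of_real)
lift_definition norm_operator :: "'a operator \<Rightarrow> real" is norm .

definition sgn_operator :: "'a operator \<Rightarrow> 'a operator"
  where "sgn_operator A = inverse (norm A) *\<^sub>R A"
definition dist_operator :: "'a operator \<Rightarrow> 'a operator \<Rightarrow> real"
  where "dist_operator A B = norm (A - B)"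
definition uniformity_operator :: "('a operator \<times> 'a operator) filter"
  where "uniformity_operator = (INF e\<in>{0<..}. principal {(A, B). dist A B < e})"
definition open_operator :: "'a operator set \<Rightarrow> bool"
  where "open_operator U = (\<forall>A\<in>U. \<forall>\<^sub>F (A', B) in uniformity. A' = A \<longrightarrow> B \<in> U)"

instance
proof
  fix A B C :: "'a operator" and r s :: real and U :: "'a operator set"
  show "A + B + C = A + (B + C)" by transfer simp
  show "A + B = B + A" by transfer simp
  show "0 + A = A" by transfer simp
  show "- A + A = 0" by transfer simp
  show "A - B = A + - B" by transfer simp
  show "r *\<^sub>R (A + B) = r *\<^sub>R A + r *\<^sub>R B" by transfer (simp add: scaleR_add_right)
  show "(r + s) *\<^sub>R A = r *\<^sub>R A + s *\<^sub>R A" by transfer (simp add: scaleR_add_left)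
  show "r *\<^sub>R s *\<^sub>R A = (r * s) *\<^sub>R A" by transfer simp
  show "1 *\<^sub>R A = A" by transfer simp
  show "norm A = 0 \<longleftrightarrow> A = 0" by transfer simp
  show "norm (A + B) \<le> norm A + norm B" by transfer (rule norm_triangle_ineq)
  show "norm (r *\<^sub>R A) = \<bar>r\<bar> * norm A" by transfer simp
qed (simp_all add: sgn_operator_def dist_operator_def uniformity_operator_def
      open_operator_def)

end

lemma app_add: "app (A + B) x = app A x + app B x"
  by transfer (rule blinfun.add_left)

lemma app_scaleR: "app (r *\<^sub>R A) x = r *\<^sub>R app A x"
  by transfer (rule blinfun.scaleR_left)

lemma norm_app: "norm (app A x) \<le> norm A * norm x"
  by transfer (rule norm_blinfun)

lemma dist_blinfun_of_operator:
  "dist (blinfun_of_operator A) (blinfun_of_operator B) = dist A B"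
  by (simp add: dist_norm norm_operator.rep_eq minus_operator.rep_eq)

instance operator :: (complex_banach) banach
proof
  fix F :: "nat \<Rightarrow> 'a operator"
  assume "Cauchy F"
  then have "Cauchy (\<lambda>n. blinfun_of_operator (F n))"
    by (simp add: Cauchy_def dist_blinfun_of_operator)
  then obtain g where g: "(\<lambda>n. blinfun_of_operator (F n)) \<longlonglongrightarrow> g"
    using Cauchy_convergent convergent_def by blast
  have lim: "(\<lambda>n. blinfun_of_operator (F n) x) \<longlonglongrightarrow> g x" for x
    by (intro blinfun.tendsto g tendsto_const)
  have "g (c *\<^sub>C x) = c *\<^sub>C g x" for c x
  proof (rule LIMSEQ_unique[OF lim])
    have "blinfun_of_operator (F n) (c *\<^sub>C x) = c *\<^sub>C blinfun_of_operator (F n) x" for n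
      using blinfun_of_operator[of "F n"] by simp
    then show "(\<lambda>n. blinfun_of_operator (F n) (c *\<^sub>C x)) \<longlonglongrightarrow> c *\<^sub>C g x"
      using bounded_linear.tendsto[OF bounded_linear_scaleC lim] by simp
  qed
  then have "blinfun_of_operator (Abs_operator g) = g"
    by (simp add: Abs_operator_inverse)
  then have "F \<longlonglongrightarrow> Abs_operator g"
    using g unfolding tendsto_iff
    by (metis (no_types, lifting) dist_blinfun_of_operator eventually_mono)
  then show "convergent F"
    by (auto simp: convergent_def)
qed

instantiation operator :: (complex_banach) complex_banach
begin

lift_definition scaleC_operator :: "complex \<Rightarrow> 'a operator \<Rightarrow> 'a operator"
  is "\<lambda>c f. Blinfun (scaleC c) o\<^sub>L f"
  by (simp add: bounded_linear_Blinfun_apply bounded_linear_scaleC scaleC_scaleC mult.commute)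

lemma app_scaleC: "app (c *\<^sub>C A) x = c *\<^sub>C app A x"
  by transfer (simp add: bounded_linear_Blinfun_apply bounded_linear_scaleC)

instance
proof
  fix A B :: "'a operator" and c d :: complex and r :: real
  show "c *\<^sub>C (A + B) = c *\<^sub>C A + c *\<^sub>C B"
    by (rule operator_eqI) (simp add: app_scaleC app_add scaleC_add_right)
  show "(c + d) *\<^sub>C A = c *\<^sub>C A + d *\<^sub>C A"
    by (rule operator_eqI) (simp add: app_scaleC app_add scaleC_add_left)
  show "c *\<^sub>C d *\<^sub>C A = (c * d) *\<^sub>C A"
    by (rule operator_eqI) (simp add: app_scaleC scaleC_scaleC)
  show "complex_of_real r *\<^sub>C A = r *\<^sub>R A"
    by (rule operator_eqI) (simp add: app_scaleC app_scaleR scaleC_of_real)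
  have le: "norm (c *\<^sub>C A) \<le> cmod c * norm A" for c and A :: "'a operator"
  proof -
    have "norm (app (c *\<^sub>C A) x) \<le> cmod c * norm A * norm x" for x
      unfolding app_scaleC norm_scaleC mult.assoc by (intro mult_left_mono norm_app) simp
    then show ?thesis
      unfolding app.rep_eq norm_operator.rep_eq
      by (intro norm_blinfun_bound) simp_all
  qed
  show "norm (c *\<^sub>C A) = cmod c * norm A"
  proof (cases "c = 0")
    case True
    then show ?thesis using le[of 0 A] by simp
  next
    case False
    have "inverse c *\<^sub>C c *\<^sub>C A = A"
      by (rule operator_eqI) (simp add: app_scaleC scaleC_scaleC False)
    then have "norm A \<le> inverse (cmod c) * norm (c *\<^sub>C A)"
      using le[of "inverse c" "c *\<^sub>C A"] by (simp add: norm_inverse)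
    then have "cmod c * norm A \<le> norm (c *\<^sub>C A)"
      using False by (simp add: field_simps)
    then show ?thesis using le[of c A] by simp
  qed
qed

end

instantiation operator :: (complex_banach) "{real_normed_algebra, monoid_mult}"
begin

lift_definition times_operator :: "'a operator \<Rightarrow> 'a operator \<Rightarrow> 'a operator" is "(o\<^sub>L)"
  by simp
lift_definition one_operator :: "'a operator" is id_blinfun by simp

instance
proof
  fix A B C :: "'a operator" and r :: real
  show "A * B * C = A * (B * C)" by transfer (auto intro: blinfun_eqI)
  show "(A + B) * C = A * C + B * C"
    by transfer (auto intro: blinfun_eqI simp: blinfun.add_left)
  show "A * (B + C) = A * B + A * C"
    by transfer (auto intro: blinfun_eqI simp: blinfun.add_left blinfun.add_right)
  show "r *\<^sub>R A * B = r *\<^sub>R (A * B)"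
    by transfer (auto intro: blinfun_eqI simp: blinfun.scaleR_left)
  show "A * r *\<^sub>R B = r *\<^sub>R (A * B)"
    by transfer (auto intro: blinfun_eqI simp: blinfun.scaleR_left blinfun.scaleR_right)
  show "norm (A * B) \<le> norm A * norm B" by transfer (rule norm_blinfun_compose)
  show "1 * A = A" by transfer (auto intro: blinfun_eqI)
  show "A * 1 = A" by transfer (auto intro: blinfun_eqI)
qed

end

definition null_space :: "'a::complex_banach operator \<Rightarrow> 'a set"
  where "null_space T = {x. app T x = 0}"

definition range_space :: "'a::complex_banach operator \<Rightarrow> 'a set"
  where "range_space T = range (app T)"


section \<open>Hermitian, EP and Fredholm operators\<close>

text \<open>The library's \<^const>\<open>exp\<close> needs a unital algebra with \<open>norm 1 = 1\<close>, which fails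
  over the zero space.\<close>

definition operator_exp :: "'a::complex_banach operator \<Rightarrow> 'a operator"
  where "operator_exp T = (\<Sum>n. T ^ n /\<^sub>R fact n)"

definition hermitian :: "'a::complex_banach operator \<Rightarrow> bool"
  where "hermitian H \<longleftrightarrow> (\<forall>t::real. norm (operator_exp ((\<i> * complex_of_real t) *\<^sub>C H)) = 1)"

definition is_moore_penrose :: "'a::complex_banach operator \<Rightarrow> 'a operator \<Rightarrow> bool"
  where "is_moore_penrose T S \<longleftrightarrow>
    T = T * S * T \<and> S = S * T * S \<and> hermitian (T * S) \<and> hermitian (S * T)"

definition has_moore_penrose :: "'a::complex_banach operator \<Rightarrow> bool"
  where "has_moore_penrose T \<longleftrightarrow> (\<exists>S. is_moore_penrose T S)"

text \<open>Meaningful because a Moore--Penrose inverse is unique when it exists; unspecified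
  otherwise.\<close>

definition moore_penrose :: "'a::complex_banach operator \<Rightarrow> 'a operator"  ("_\<^sup>\<dagger>" [1000] 1000)
  where "T\<^sup>\<dagger> = (THE S. is_moore_penrose T S)"

definition EP :: "'a::complex_banach operator \<Rightarrow> bool"
  where "EP T \<longleftrightarrow> has_moore_penrose T \<and> T * T\<^sup>\<dagger> = T\<^sup>\<dagger> * T"

text \<open>Finite codimension of \<open>R(T)\<close> means that the cosets of finitely many vectors span
  \<open>X / R(T)\<close>, i.e. that these vectors together with \<open>R(T)\<close> span \<open>X\<close>.\<close>

definition fredholm :: "'a::complex_banach operator \<Rightarrow> bool"
  where "fredholm T \<longleftrightarrow>
    closed (range_space T) \<and>
    (\<exists>B. finite B \<and> null_space T = complex_vector.span B) \<and>
    (\<exists>B. finite B \<and> complex_vector.span (B \<union> range_space T) = UNIV)"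

end

theory Submission
  imports Defs
begin

text \<open>If \<open>P\<close> is a hermitian idempotent, then \<open>exp(i\<pi>P) = 1 - 2P\<close> is a reflection of norm at most 1. For
  two such idempotents with \<open>PE = E\<close> the difference \<open>D = EP - E\<close> satisfies \<open>D\<^sup>2 = 0\<close> and
  \<open>((1 - 2P)(1 - 2E))\<^sup>2 = 1 - 4D\<close>; the powers \<open>1 - 4nD\<close> stay bounded, so \<open>D = 0\<close>. Hence \<open>PE = E\<close> and
  \<open>EP = E\<close> are equivalent, i.e. inclusions of ranges turn into inclusions of null spaces and back. Parts (i)
  and (ii) are this equivalence for the projections of \<open>S\<close>, \<open>T\<close> and \<open>ST\<close>. For (iv), \<open>T\<close> acts injectively on
  the finite-dimensional space \<open>N(S) \<inter> R(T)\<close>, hence surjectively, which gives the null space; dually, \<open>S\<close>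
  induces a surjective, hence injective, map on the finite-dimensional quotient \<open>R(S)/R(ST)\<close>, which gives
  the range.\<close>

section \<open>Finite-dimensional linear algebra\<close>

text \<open>The exchange bound makes a maximal independent subset of \<open>V\<close> finite. With
  \<open>V = span B\<close> this trades a possibly dependent \<open>B\<close> for a basis.\<close>

lemma (in vector_space) finite_basis_of_subspace:
  assumes "finite B" and "subspace V" and "V \<subseteq> span B"
  obtains C where "finite C" and "independent C" and "span C = V"
proof -
  obtain C where C: "C \<subseteq> V" "independent C" "V \<subseteq> span C"
    by (rule maximal_independent_subset)
  show thesis
  proof
    show "finite C"
      using independent_span_bound[of B C] assms C by blast
    show "span C = V"
      using C assms(2) by (meson span_minimal subset_antisym)
  qed (fact C)
qed

text \<open>The image of a basis is again independent and of the same size; a vector outside its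
  span would extend it beyond the dimension.\<close>

lemma (in vector_space) inj_on_span_imp_surj_on_span:
  assumes lin: "Vector_Spaces.linear scale scale f" and fin: "finite B"
    and into: "f ` span B \<subseteq> span B" and inj: "inj_on f (span B)"
  shows "f ` span B = span B"
proof
  interpret vector_space_pair scale scale ..
  obtain C where finC: "finite C" and indC: "independent C" and span: "span C = span B"
    using finite_basis_of_subspace[OF fin subspace_span subset_refl] by metis
  have C: "C \<subseteq> span B" "independent C"
    using indC span span_superset by auto
  have indep: "independent (f ` C)"
    using linear_independent_injective_image[OF lin C(2)] inj span by simp
  have card: "card (f ` C) = card C"
    using inj C(1) by (meson card_image inj_on_subset)
  show "span B \<subseteq> f ` span B"
  proof
    fix v assume v: "v \<in> span B"
    have "v \<in> span (f ` C)"
    proof (rule ccontr)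
      assume nv: "v \<notin> span (f ` C)"
      then have "independent (insert v (f ` C))"
        using indep by (rule independent_insertI)
      moreover have "insert v (f ` C) \<subseteq> span C"
        using v into C(1) span by auto
      ultimately have "card (insert v (f ` C)) \<le> card C"
        using independent_span_bound[OF finC] by blast
      moreover have "v \<notin> f ` C"
        using nv span_base by blast
      ultimately show False using card finC by simp
    qed
    then show "v \<in> f ` span B"
      using linear_span_image[OF lin] span by auto
  qed
qed (fact into)

text \<open>The image of a basis of \<open>span B\<close> spans at least \<open>span B\<close>, so
  counting makes it independent and free of repetitions, and the kernel of \<open>f\<close> there is
  trivial.\<close>

lemma (in vector_space) surj_on_span_imp_inj_on_span:
  assumes lin: "Vector_Spaces.linear scale scale f" and fin: "finite B"
    and surj: "span B \<subseteq> f ` span B" and x: "x \<in> span B" "f x = 0"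
  shows "x = 0"
proof -
  interpret vector_space_pair scale scale ..
  obtain C where finC: "finite C" and indC: "independent C" and span: "span C = span B"
    using finite_basis_of_subspace[OF fin subspace_span subset_refl] by metis
  have C: "C \<subseteq> span B" "independent C"
    using indC span span_superset by auto
  have CfC: "C \<subseteq> span (f ` C)"
    using C(1) surj span linear_span_image[OF lin] by blast
  have "card C \<le> card (f ` C)"
    using independent_span_bound[OF finite_imageI[OF finC] C(2) CfC] by simp
  then have card: "card (f ` C) = card C"
    using card_image_le[OF finC, of f] by simp
  then have inj: "inj_on f C"
    using finC eq_card_imp_inj_on by blast
  have "independent (f ` C)"
  proof
    assume "dependent (f ` C)"
    then obtain a where a: "a \<in> f ` C" "a \<in> span (f ` C - {a})"
      by (auto simp: dependent_def)
    then have "C \<subseteq> span (f ` C - {a})"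
      using CfC span_redundant[OF a(2)] a(1) by (simp add: insert_absorb)
    then have "card C \<le> card (f ` C - {a})"
      using independent_span_bound[of "f ` C - {a}" C] finC C(2) by simp
    then show False
      using a(1) card finC by (metis card_Diff1_less finite_imageI not_le)
  qed
  then show ?thesis
    using linear_indep_image_lemma[OF lin finC _ inj] x span by blast
qed

section \<open>Projections with contractive reflections\<close>

text \<open>The power \<open>(1 + D) ^ n\<close> is \<open>1 + n D\<close>, which grows linearly
  unless \<open>D = 0\<close>, whereas powers of a contraction stay bounded.\<close>

lemma bounded_unipotent_imp_zero:
  fixes D :: "'a::{real_normed_algebra, monoid_mult}"
  assumes "D * D = 0" and "norm (1 + D) \<le> 1"
  shows "D = 0"
proof (rule ccontr)
  assume "D \<noteq> 0"
  have power: "(1 + D) ^ n = 1 + real n *\<^sub>R D" for n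
    by (induction n) (simp_all add: algebra_simps assms(1))
  \<comment> \<open>Only positive powers: \<open>norm 1\<close> need not be at most 1 in this
    class.\<close>
  have le: "norm ((1 + D) ^ Suc n) \<le> 1" for n
  proof (induction n)
    case (Suc n)
    have "norm ((1 + D) ^ Suc (Suc n)) \<le> norm (1 + D) * norm ((1 + D) ^ Suc n)"
      by (simp only: power_Suc[of _ "Suc n"] norm_mult_ineq)
    also have "\<dots> \<le> 1"
      using assms(2) Suc by (simp add: mult_le_one)
    finally show ?case .
  qed (use assms(2) in simp)
  obtain n where n: "1 + norm (1::'a) < real n * norm D"
    using \<open>D \<noteq> 0\<close> reals_Archimedean3[of "norm D"] by auto
  have "norm (real (Suc n) *\<^sub>R D) = norm ((1 + D) ^ Suc n - 1)"
    by (subst power) simp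
  also have "\<dots> \<le> 1 + norm (1::'a)"
    using norm_triangle_ineq4[of "(1 + D) ^ Suc n" 1] le[of n] by linarith
  finally have "real (Suc n) * norm D \<le> 1 + norm (1::'a)"
    by simp
  moreover have "real n * norm D \<le> real (Suc n) * norm D"
    by (intro mult_right_mono) simp_all
  ultimately show False
    using n by linarith
qed

text \<open>All that is kept of a hermitian idempotent is the bound on its reflection, a condition
  free of exponentials.\<close>

definition contractive_projection :: "'a::{real_normed_algebra, monoid_mult} \<Rightarrow> bool"
  where "contractive_projection P \<longleftrightarrow> P * P = P \<and> norm (1 - 2 *\<^sub>R P) \<le> 1"

text \<open>Passing to the complement only changes the sign of the reflection.\<close>

lemma contractive_projection_complement:
  assumes "contractive_projection P"
  shows "contractive_projection (1 - P)"
proof -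
  have "1 - 2 *\<^sub>R (1 - P) = - (1 - 2 *\<^sub>R P)"
    by (simp add: algebra_simps) (simp add: scaleR_2)
  then have "norm (1 - 2 *\<^sub>R (1 - P)) = norm (1 - 2 *\<^sub>R P)"
    by (simp only: norm_minus_cancel)
  then show ?thesis
    using assms by (simp add: contractive_projection_def algebra_simps)
qed

lemma contractive_projection_absorb_left:
  fixes P E :: "'a::{real_normed_algebra, monoid_mult}"
  assumes P: "contractive_projection P" and E: "contractive_projection E" and PE: "P * E = E"
  shows "E * P = E"
proof -
  define D where "D = E * P - E"
  define U where "U = (1 - 2 *\<^sub>R P) * (1 - 2 *\<^sub>R E)"
  \<comment> \<open>The versions with a trailing \<open>z\<close> apply inside right-associated
    products.\<close>
  have idem: "P * P = P" "E * E = E" "P * (E * z) = E * z" "P * (P * z) = P * z"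
    "E * (E * z) = E * z" for z
    using P E PE by (auto simp: contractive_projection_def simp flip: mult.assoc)
  \<comment> \<open>\<open>D\<close> is \<open>- E * (1 - P)\<close>, and
    \<open>(1 - P) * E = 0\<close>.\<close>
  have DD: "D * D = 0"
    by (simp add: D_def algebra_simps idem PE)
  have U: "U = 1 - (P + P) + (E + E)"
    unfolding U_def scaleR_2 by (simp add: algebra_simps idem PE)
  have UU: "U * U = 1 - (D + D + D + D)"
    by (simp add: U D_def algebra_simps idem PE)
  have four: "D + D + D + D = 4 *\<^sub>R D"
    using scaleR_left_distrib[of 2 2 D] by (simp add: scaleR_2 add.assoc)
  have "norm U \<le> 1"
    using norm_mult_ineq[of "1 - 2 *\<^sub>R P" "1 - 2 *\<^sub>R E"] P E
    unfolding U_def contractive_projection_def by (meson mult_le_one norm_ge_zero order_trans)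
  then have "norm (U * U) \<le> 1"
    using norm_mult_ineq[of U U] by (meson mult_le_one norm_ge_zero order_trans)
  then have "norm (1 + (- 4) *\<^sub>R D) \<le> 1"
    unfolding UU four by simp
  moreover have "((- 4) *\<^sub>R D) * ((- 4) *\<^sub>R D) = 0"
    by (simp add: DD)
  ultimately have "(- 4) *\<^sub>R D = 0"
    by (rule bounded_unipotent_imp_zero[rotated])
  then show ?thesis by (simp add: D_def)
qed

text \<open>For operators the two equations say that R(E) lies in R(P) and that N(P) lies in N(E).
  The converse is the previous implication for the complements, with the roles of \<open>P\<close>
  and \<open>E\<close> exchanged.\<close>

lemma contractive_projection_absorb_iff:
  assumes "contractive_projection P" and "contractive_projection E"
  shows "P * E = E \<longleftrightarrow> E * P = E"
proof
  assume "E * P = E"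
  then have "(1 - E) * (1 - P) = 1 - P"
    by (simp add: algebra_simps)
  then have "(1 - P) * (1 - E) = 1 - P"
    using assms by (intro contractive_projection_absorb_left contractive_projection_complement)
  then show "P * E = E"
    by (simp add: algebra_simps)
qed (use assms contractive_projection_absorb_left in blast)

section \<open>Exponentials of idempotent operators\<close>

lemma app_simps [simp]:
  "app (A * B) x = app A (app B x)" "app 1 x = x" "app (A - B) x = app A x - app B x"
  "app 0 x = 0"
  by (transfer, simp add: blinfun.diff_left)+

lemma linear_app: "Vector_Spaces.linear scaleC scaleC (app A)"
  unfolding Vector_Spaces.linear_iff
  using complex_vector.vector_space_axioms blinfun_of_operator[of A]
  by (auto simp: app.rep_eq blinfun.add_right)

lemma app_linear [simp]:
  "app A (x + y) = app A x + app A y" "app A (x - y) = app A x - app A y" "app A 0 = 0"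
  by (simp_all add: app.rep_eq blinfun.add_right blinfun.diff_right blinfun.zero_right)

lemma operator_exp_projection:
  fixes P :: "'a::complex_banach operator"
  assumes "P * P = P"
  shows "operator_exp (c *\<^sub>C P) = (1 - P) + exp c *\<^sub>C P"
proof -
  have scale: "(a *\<^sub>C P) * (b *\<^sub>C P) = (a * b) *\<^sub>C P" for a b
  proof (rule operator_eqI)
    fix x
    have "app P (b *\<^sub>C app P x) = b *\<^sub>C app P (app P x)"
      using linear_app[of P] by (auto simp only: Vector_Spaces.linear_iff)
    also have "app P (app P x) = app P x"
      using arg_cong[OF assms, of "\<lambda>A. app A x"] by simp
    finally show "app ((a *\<^sub>C P) * (b *\<^sub>C P)) x = app ((a * b) *\<^sub>C P) x"
      by (simp add: app_scaleC scaleC_scaleC)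
  qed
  have power: "(c *\<^sub>C P) ^ Suc n = c ^ Suc n *\<^sub>C P" for n
    by (induction n) (simp_all add: scale)
  have "bounded_linear (\<lambda>a. a *\<^sub>C P)"
    by (rule bounded_linear_intro[where K = "norm P"])
      (simp_all add: scaleC_add_left norm_scaleC scaleC_scaleC scaleR_conv_of_real
        flip: scaleC_of_real)
  then have "(\<lambda>n. (c ^ n /\<^sub>R fact n) *\<^sub>C P) sums (exp c *\<^sub>C P)"
    using exp_converges by (rule bounded_linear.sums)
  \<comment> \<open>The powers of \<open>c P\<close> are \<open>c ^ n P\<close> for positive
    \<open>n\<close> only; the constant term is \<open>1\<close> instead of \<open>P\<close>, and
    the summand \<open>1 - P\<close> makes up the difference.\<close>
  then have "(\<lambda>n. (if n = 0 then 1 - P else 0) + (c ^ n /\<^sub>R fact n) *\<^sub>C P)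
      sums ((1 - P) + exp c *\<^sub>C P)"
    using sums_single[of 0 "\<lambda>_. 1 - P"] by (intro sums_add) auto
  moreover have "(if n = 0 then 1 - P else 0) + (c ^ n /\<^sub>R fact n) *\<^sub>C P = (c *\<^sub>C P) ^ n /\<^sub>R fact n"
    for n
  proof (cases n)
    case (Suc m)
    then show ?thesis
      by (simp only: power) (simp add: scaleC_scaleC scaleR_conv_of_real flip: scaleC_of_real)
  qed (simp add: scaleC_one)
  ultimately show ?thesis
    by (simp add: operator_exp_def sums_iff)
qed

lemma hermitian_imp_contractive_projection:
  assumes "hermitian P" and "P * P = P"
  shows "contractive_projection P"
proof -
  \<comment> \<open>The hermitian condition is used at the single parameter t = pi.\<close>
  have "operator_exp ((\<i> * complex_of_real pi) *\<^sub>C P) = 1 - P + complex_of_real (- 1) *\<^sub>C P"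
    by (simp add: operator_exp_projection[OF assms(2)] exp_pi_i')
  also have "\<dots> = 1 - 2 *\<^sub>R P"
    by (subst scaleC_of_real) (simp add: scaleR_2)
  finally show ?thesis
    using assms by (metis contractive_projection_def hermitian_def order_refl)
qed

section \<open>Inclusions of ranges and null spaces as product equations\<close>

text \<open>The range of an idempotent is its set of fixed points.\<close>

lemma range_space_subset_iff:
  assumes "P * P = P"
  shows "range_space A \<subseteq> range_space P \<longleftrightarrow> P * A = A"
proof
  assume le: "range_space A \<subseteq> range_space P"
  show "P * A = A"
  proof (rule operator_eqI)
    fix x
    obtain y where "app A x = app P y"
      using le by (auto simp: range_space_def)
    then show "app (P * A) x = app A x"
      using arg_cong[OF assms, of "\<lambda>B. app B y"] by simp
  qed
next
  assume "P * A = A"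
  then show "range_space A \<subseteq> range_space P"
    unfolding range_space_def by (metis app_simps(1) image_subsetI rangeI)
qed

text \<open>The null space of an idempotent consists of the vectors
  \<open>x - app P x\<close>.\<close>

lemma null_space_subset_iff:
  assumes "P * P = P"
  shows "null_space P \<subseteq> null_space A \<longleftrightarrow> A * P = A"
proof
  assume le: "null_space P \<subseteq> null_space A"
  show "A * P = A"
  proof (rule operator_eqI)
    fix x
    have "x - app P x \<in> null_space P"
      using arg_cong[OF assms, of "\<lambda>B. app B x"] by (simp add: null_space_def)
    then have "app A (x - app P x) = 0"
      using le unfolding null_space_def by blast
    then show "app (A * P) x = app A x"
      by simp
  qed
next
  assume "A * P = A"
  then show "null_space P \<subseteq> null_space A"
    unfolding null_space_def by (metis (mono_tags, lifting) Collect_mono app_linear(3) app_simps(1))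
qed

lemma range_space_mult_subset: "range_space (A * B) \<subseteq> range_space A"
  by (auto simp: range_space_def)

lemma null_space_mult_superset: "null_space B \<subseteq> null_space (A * B)"
  by (auto simp: null_space_def)

section \<open>Moore-Penrose inverses and EP operators\<close>

text \<open>R(T) = R(TST) lies in R(TS), which lies in R(T); the null spaces are squeezed
  likewise.\<close>

lemma is_moore_penrose_projections:
  assumes "is_moore_penrose T S"
  shows "contractive_projection (T * S)" and "contractive_projection (S * T)"
    and "range_space (T * S) = range_space T" and "null_space (S * T) = null_space T"
proof -
  have eqs: "T * S * T = T" "S * T * S = S"
    using assms by (simp_all add: is_moore_penrose_def)
  show "contractive_projection (T * S)" "contractive_projection (S * T)"
    using assms eqs
    by (auto simp: is_moore_penrose_def mult.assoc intro!: hermitian_imp_contractive_projection)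
  show "range_space (T * S) = range_space T"
    using range_space_mult_subset[of T S] range_space_mult_subset[of "T * S" T] eqs by simp
  show "null_space (S * T) = null_space T"
    using null_space_mult_superset[of T S] null_space_mult_superset[of "S * T" T] eqs
    by (simp add: mult.assoc)
qed

text \<open>\<open>T * S\<close> and \<open>T * S'\<close> have the same range, so absorption
  identifies them; \<open>S * T\<close> and \<open>S' * T\<close> have the same null space. Then S =
  STS = STS' = S'TS' = S'.\<close>

lemma is_moore_penrose_unique:
  assumes "is_moore_penrose T S" and "is_moore_penrose T S'"
  shows "S = S'"
proof -
  have eqs: "T * S * T = T" "S * T * S = S" "T * S' * T = T" "S' * T * S' = S'"
    using assms by (simp_all add: is_moore_penrose_def)
  have range: "T * S = T * S'"
    using contractive_projection_absorb_iff[of "T * S" "T * S'"] eqs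
      is_moore_penrose_projections(1)[OF assms(1)] is_moore_penrose_projections(1)[OF assms(2)]
    by (simp flip: mult.assoc)
  have null: "S * T = S' * T"
    using contractive_projection_absorb_iff[of "S' * T" "S * T"] eqs
      is_moore_penrose_projections(2)[OF assms(1)] is_moore_penrose_projections(2)[OF assms(2)]
    by (simp add: mult.assoc)
  show ?thesis
    using eqs range null by (metis mult.assoc)
qed

lemma is_moore_penrose_moore_penrose:
  assumes "has_moore_penrose T"
  shows "is_moore_penrose T (T\<^sup>\<dagger>)"
  unfolding moore_penrose_def
  using assms is_moore_penrose_unique unfolding has_moore_penrose_def by (metis theI)

text \<open>Commutation merges the two projections, so that one idempotent carries both R(T) and
  N(T).\<close>

lemma EP_imp_commuting_projection:
  assumes "EP T"
  obtains P where "contractive_projection P" and "P = T * T\<^sup>\<dagger>" and "P = T\<^sup>\<dagger> * T"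
    and "range_space P = range_space T" and "null_space P = null_space T"
  using assms is_moore_penrose_projections[OF is_moore_penrose_moore_penrose, of T]
  unfolding EP_def by metis

section \<open>Null space and range of a product under finiteness conditions\<close>

lemma null_space_mult_eq_sum:
  fixes S T Q :: "'a::complex_banach operator"
  assumes idem: "Q * Q = Q" and range: "range_space Q = range_space T"
    and null: "null_space Q = null_space T"
    and fin: "finite B" "null_space S = complex_vector.span B"
    and le: "null_space S \<subseteq> null_space (S * T)"
  shows "null_space (S * T) = null_space S + null_space T"
proof
  have QT: "Q * T = T" and TQ: "T * Q = T"
    using range_space_subset_iff[OF idem, of T] null_space_subset_iff[OF idem, of T] range null
    by simp_all
  \<comment> \<open>The fixed points of \<open>Q\<close> form R(T), so \<open>K\<close> is the
    intersection of N(S) and R(T).\<close>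
  define K where "K = {x. app S x = 0 \<and> app Q x = x}"
  have "complex_vector.subspace K"
    unfolding K_def using linear_app[of S] linear_app[of Q]
    by (auto simp: complex_vector.subspace_def Vector_Spaces.linear_iff)
  then obtain C where C: "finite C" "complex_vector.span C = K"
    using complex_vector.finite_basis_of_subspace[OF fin(1)] fin(2)
    by (metis (no_types, lifting) K_def mem_Collect_eq null_space_def subsetI)
  have into: "app T ` K \<subseteq> K"
    using le arg_cong[OF QT, of "\<lambda>A. app A _"] by (auto simp: K_def null_space_def)
  \<comment> \<open>R(T) and N(T) meet only in 0, being range and null space of
    \<open>Q\<close>.\<close>
  have inj: "x = y" if "app Q x = x" "app Q y = y" "app T x = app T y" for x y
  proof -
    have "x - y \<in> null_space Q"
      using that null by (simp add: null_space_def)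
    then show ?thesis
      using that by (simp add: null_space_def)
  qed
  have surj: "app T ` K = K"
    using complex_vector.inj_on_span_imp_surj_on_span[OF linear_app C(1), of T] into inj
    unfolding C(2) by (auto simp: inj_on_def K_def)
  show "null_space (S * T) \<subseteq> null_space S + null_space T"
  proof
    fix x assume "x \<in> null_space (S * T)"
    then have STx: "app S (app T x) = 0"
      by (simp add: null_space_def)
    have TQx: "app T (app Q x) = app T x" and QTx: "app Q (app T x) = app T x"
      and QQx: "app Q (app Q x) = app Q x"
      using TQ QT idem by (simp_all flip: app_simps(1))
    have "app T x \<in> K"
      using STx QTx by (simp add: K_def)
    then obtain k where k: "k \<in> K" "app T k = app T x"
      using surj by (metis imageE)
    \<comment> \<open>Both vectors are fixed by \<open>Q\<close> and have the same image under
      \<open>T\<close>. Hence x = k + (x - Q x) is the required decomposition.\<close>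
    then have "app Q x = k"
      using inj TQx QQx by (simp add: K_def)
    then have "app Q x \<in> null_space S" "x - app Q x \<in> null_space T"
      using k TQx by (auto simp: K_def null_space_def)
    then show "x \<in> null_space S + null_space T"
      using set_plus_intro by fastforce
  qed
  show "null_space S + null_space T \<subseteq> null_space (S * T)"
    using le by (auto simp: null_space_def elim!: set_plus_elim)
qed

lemma range_space_mult_eq_inter:
  fixes S T P E :: "'a::complex_banach operator"
  assumes idem: "P * P = P" "E * E = E" and range: "range_space P = range_space S"
    and E: "range_space E = range_space (S * T)"
    and SS: "range_space S \<subseteq> range_space (S * S)"
    and fin: "finite B" "complex_vector.span (B \<union> range_space T) = UNIV"
    and le: "range_space (S * T) \<subseteq> range_space T"
  shows "range_space (S * T) = range_space S \<inter> range_space T"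
proof
  show "range_space (S * T) \<subseteq> range_space S \<inter> range_space T"
    using le range_space_mult_subset[of S T] by blast
  have EST: "app E (app S (app T x)) = app S (app T x)" for x
    using range_space_subset_iff[OF idem(2), of "S * T"] E by (simp flip: app_simps(1))
  have PS: "app P (app S x) = app S x" for x
    using range_space_subset_iff[OF idem(1), of S] range by (simp flip: app_simps(1))
  have PE: "app P (app E x) = app E x" for x
    using range_space_subset_iff[OF idem(1), of E] range E range_space_mult_subset[of S T]
    by (simp flip: app_simps(1))
  have EE: "app E (app E x) = app E x" for x
    using idem(2) by (simp flip: app_simps(1))
  \<comment> \<open>\<open>S\<close> maps R(ST) into itself because R(ST) lies in R(T); so it
    induces a map modulo R(ST).\<close>
  have ESE: "app E (app S (app E x)) = app S (app E x)" for x
  proof -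
    have "app E x \<in> range_space T"
      using E le by (auto simp: range_space_def)
    then show ?thesis
      using EST by (auto simp: range_space_def)
  qed
  \<comment> \<open>\<open>C\<close> is a complement of \<open>R(ST)\<close> in \<open>R(S)\<close>, and \<open>g\<close> the map that \<open>S\<close> induces on it.\<close>
  define C where "C = {x. app P x = x \<and> app E x = 0}"
  have C_S: "C \<subseteq> range_space S"
  proof
    fix c assume "c \<in> C"
    then have "c = app P c"
      by (simp add: C_def)
    then have "c \<in> range_space P"
      unfolding range_space_def by (rule range_eqI)
    then show "c \<in> range_space S"
      by (simp only: range)
  qed
  define g where "g = app ((1 - E) * S)"
  have g: "g x = app S x - app E (app S x)" for x
    by (simp add: g_def)
  have lin: "Vector_Spaces.linear scaleC scaleC g"
    unfolding g_def by (rule linear_app)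
  interpret vector_space_pair "scaleC :: complex \<Rightarrow> 'a \<Rightarrow> 'a" "scaleC :: complex \<Rightarrow> 'a \<Rightarrow> 'a" ..
  have "complex_vector.subspace C"
    unfolding C_def using linear_app[of P] linear_app[of E]
    by (auto simp: complex_vector.subspace_def Vector_Spaces.linear_iff)
  moreover have "g ` B \<subseteq> C"
    by (auto simp: C_def g PS PE EE)
  ultimately have "complex_vector.span (g ` B) \<subseteq> C"
    by (simp add: complex_vector.span_minimal)
  \<comment> \<open>Finite codimension of R(T) enters here: \<open>g\<close> kills R(T), so only the
    component in \<open>span B\<close> of a preimage matters.\<close>
  moreover have "C \<subseteq> complex_vector.span (g ` B)"
  proof
    fix c assume c: "c \<in> C"
    then have "c \<in> range_space S"
      using C_S by blast
    then obtain x where x: "c = app S x"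
      by (auto simp: range_space_def)
    have "complex_vector.subspace (range_space T)"
      unfolding range_space_def
      by (rule linear_subspace_image[OF linear_app complex_vector.subspace_UNIV])
    then have span_T: "complex_vector.span (range_space T) = range_space T"
      by (simp only: complex_vector.span_eq_iff)
    have "x \<in> complex_vector.span (B \<union> range_space T)"
      by (simp only: fin(2) UNIV_I)
    then obtain u w where u: "u \<in> complex_vector.span B" and uw: "x = u + app T w"
      unfolding complex_vector.span_Un span_T by (auto simp only: range_space_def)
    have "c = app S x - app E (app S x)"
      using c x by (simp add: C_def)
    also have "\<dots> = g u"
      by (simp add: uw g EST)
    finally have "c = g u" .
    then show "c \<in> complex_vector.span (g ` B)"
      using u linear_span_image[OF lin] by blast
  qed
  ultimately have C: "complex_vector.span (g ` B) = C"
    by blast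
  have surj: "C \<subseteq> g ` C"
  proof
    fix c assume c: "c \<in> C"
    then have "c \<in> range_space (S * S)"
      using C_S SS by blast
    then obtain z where z: "c = app S (app S z)"
      by (auto simp: range_space_def)
    \<comment> \<open>The component of S z in \<open>C\<close>; by \<open>ESE\<close> the part
      removed does not affect \<open>g\<close>.\<close>
    define c' where "c' = app S z - app E (app S z)"
    have "c' \<in> C"
      by (simp add: c'_def C_def PS PE EE)
    moreover have "g c' = c"
      using c by (simp add: c'_def g ESE z C_def)
    ultimately show "c \<in> g ` C"
      by blast
  qed
  show "range_space S \<inter> range_space T \<subseteq> range_space (S * T)"
  proof
    fix y assume "y \<in> range_space S \<inter> range_space T"
    then obtain v w where y: "y = app S v" "y = app T w"
      unfolding range_space_def by blast
    have "y - app E y \<in> C"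
      using PS[of v] y(1) by (simp add: C_def PE EE)
    \<comment> \<open>As y = T w, the vector S y lies in R(ST).\<close>
    moreover have "g (y - app E y) = 0"
      using EST[of w] y(2) by (simp add: g ESE)
    ultimately have "y - app E y = 0"
      using complex_vector.surj_on_span_imp_inj_on_span[OF lin finite_imageI[OF fin(1)], of g, unfolded C]
        surj by blast
    then have "y \<in> range_space E"
      by (metis range_space_def rangeI right_minus_eq)
    then show "y \<in> range_space (S * T)"
      by (simp add: E)
  qed
qed

section \<open>EP products\<close>

text \<open>\<open>E\<close> carries the range of \<open>S * T\<close> and \<open>F\<close> its null
  space. Absorption with the projections of \<open>S\<close> and \<open>T\<close> gives R(F) inside
  R(E) and N(F) inside N(E), whence E = EF = F.\<close>

lemma EP_mult_if_null_range_spaces: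
  assumes EP: "EP S" "EP T" and mp: "has_moore_penrose (S * T)"
    and null: "null_space (S * T) = null_space S + null_space T"
    and range: "range_space (S * T) = range_space S \<inter> range_space T"
  shows "EP (S * T)"
proof -
  obtain P where P: "contractive_projection P"
    "range_space P = range_space S" "null_space P = null_space S"
    using EP_imp_commuting_projection[OF EP(1)] by metis
  obtain Q where Q: "contractive_projection Q"
    "range_space Q = range_space T" "null_space Q = null_space T"
    using EP_imp_commuting_projection[OF EP(2)] by metis
  define E where "E = S * T * (S * T)\<^sup>\<dagger>"
  define F where "F = (S * T)\<^sup>\<dagger> * (S * T)"
  note EF = is_moore_penrose_projections[OF is_moore_penrose_moore_penrose[OF mp],
      folded E_def F_def]
  have idem: "P * P = P" "Q * Q = Q" "E * E = E" "F * F = F"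
    using P Q EF by (auto simp: contractive_projection_def)
  have "0 \<in> null_space S" "0 \<in> null_space T"
    by (simp_all add: null_space_def)
  then have "null_space P \<subseteq> null_space F" "null_space Q \<subseteq> null_space F"
    unfolding EF(4) null P Q by (metis add_0_right add_0_left set_plus_intro subsetI)+
  then have "F * P = F" "F * Q = F"
    using null_space_subset_iff idem by blast+
  \<comment> \<open>Absorption turns the null space inclusions into R(F) inside R(S) and R(T), whose
    intersection is R(E).\<close>
  then have "P * F = F" "Q * F = F"
    using contractive_projection_absorb_iff P Q EF by blast+
  then have "range_space F \<subseteq> range_space E"
    using range_space_subset_iff[of P F] range_space_subset_iff[of Q F] idem P Q EF range by auto
  then have *: "E * F = F"
    using range_space_subset_iff idem by blast
  have "P * E = E" "Q * E = E"
    using range_space_subset_iff[of P E] range_space_subset_iff[of Q E] idem P Q EF range by auto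
  then have "E * P = E" "E * Q = E"
    using contractive_projection_absorb_iff P Q EF by blast+
  then have "null_space S \<subseteq> null_space E" "null_space T \<subseteq> null_space E"
    using null_space_subset_iff[of P E] null_space_subset_iff[of Q E] idem P Q by auto
  then have "null_space F \<subseteq> null_space E"
    unfolding EF null by (force simp: null_space_def elim!: set_plus_elim)
  then have "E * F = E"
    using null_space_subset_iff idem by blast
  then show ?thesis
    using * mp by (simp add: EP_def E_def F_def)
qed

text \<open>R(ST) always lies in R(S), and N(T) in N(ST). Since one projection \<open>E\<close>
  carries both R(ST) and N(ST), absorption converts these into the two claims.\<close>

lemma EP_mult_imp_subspaces:
  assumes EP: "EP S" "EP T" and "EP (S * T)"
  shows "range_space (S * T) \<subseteq> range_space T" and "null_space S \<subseteq> null_space (S * T)"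
proof -
  obtain P where P: "contractive_projection P"
    "range_space P = range_space S" "null_space P = null_space S"
    using EP_imp_commuting_projection[OF EP(1)] by metis
  obtain Q where Q: "contractive_projection Q"
    "range_space Q = range_space T" "null_space Q = null_space T"
    using EP_imp_commuting_projection[OF EP(2)] by metis
  obtain E where E: "contractive_projection E"
    "range_space E = range_space (S * T)" "null_space E = null_space (S * T)"
    using EP_imp_commuting_projection[OF assms(3)] by metis
  have idem: "P * P = P" "Q * Q = Q"
    using P Q by (auto simp: contractive_projection_def)
  have "P * E = E"
    using range_space_subset_iff[OF idem(1)] range_space_mult_subset P E by metis
  then have "E * P = E"
    using contractive_projection_absorb_iff P E by blast
  then show "null_space S \<subseteq> null_space (S * T)"
    using null_space_subset_iff[OF idem(1)] P E by metis
  have "E * Q = E"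
    using null_space_subset_iff[OF idem(2)] null_space_mult_superset Q E by metis
  then have "Q * E = E"
    using contractive_projection_absorb_iff Q E by blast
  then show "range_space (S * T) \<subseteq> range_space T"
    using range_space_subset_iff[OF idem(2)] Q E by metis
qed

theorem theorem21:
  fixes S T :: "'a::complex_banach operator"
  assumes "EP S" and "EP T" and "has_moore_penrose (S * T)"
  shows
    "(null_space (S * T) = null_space S + null_space T \<and>
      range_space (S * T) = range_space S \<inter> range_space T \<longrightarrow> EP (S * T)) \<and>
     (EP (S * T) \<longrightarrow>
      range_space (S * T) \<subseteq> range_space T \<and> null_space S \<subseteq> null_space (S * T)) \<and>
     ((range_space (S * T) \<subseteq> range_space T \<longleftrightarrow> (1 - T * T\<^sup>\<dagger>) * (S * T) = 0) \<and>
      (null_space S \<subseteq> null_space (S * T) \<longleftrightarrow> (S * T) * (1 - S\<^sup>\<dagger> * S) = 0)) \<and>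
     ((1 - T\<^sup>\<dagger> * T) * (S * T) = 0 \<and> (S * T) * (1 - S\<^sup>\<dagger> * S) = 0 \<and>
      fredholm S \<and> fredholm T \<longrightarrow>
      null_space (S * T) = null_space S + null_space T \<and>
      range_space (S * T) = range_space S \<inter> range_space T \<and>
      EP (S * T))"
proof -
  obtain P where P: "contractive_projection P" "P = S * S\<^sup>\<dagger>" "P = S\<^sup>\<dagger> * S"
    "range_space P = range_space S" "null_space P = null_space S"
    using EP_imp_commuting_projection[OF assms(1)] by metis
  obtain Q where Q: "contractive_projection Q" "Q = T * T\<^sup>\<dagger>" "Q = T\<^sup>\<dagger> * T"
    "range_space Q = range_space T" "null_space Q = null_space T"
    using EP_imp_commuting_projection[OF assms(2)] by metis
  have idem: "P * P = P" "Q * Q = Q"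
    using P Q by (auto simp: contractive_projection_def)
  have range: "range_space (S * T) \<subseteq> range_space T \<longleftrightarrow> (1 - Q) * (S * T) = 0"
    using range_space_subset_iff[OF idem(2), of "S * T"] Q(4) by (auto simp: algebra_simps)
  have null: "null_space S \<subseteq> null_space (S * T) \<longleftrightarrow> (S * T) * (1 - P) = 0"
    using null_space_subset_iff[OF idem(1), of "S * T"] P(5) by (auto simp: algebra_simps)
  have fredholm: "null_space (S * T) = null_space S + null_space T \<and>
      range_space (S * T) = range_space S \<inter> range_space T"
    if R: "range_space (S * T) \<subseteq> range_space T" and N: "null_space S \<subseteq> null_space (S * T)"
      and "fredholm S" "fredholm T"
  proof
    show "null_space (S * T) = null_space S + null_space T"
      using \<open>fredholm S\<close> null_space_mult_eq_sum[OF idem(2) Q(4,5) _ _ N]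
      unfolding fredholm_def by metis
    define E where "E = S * T * (S * T)\<^sup>\<dagger>"
    note E = is_moore_penrose_projections[OF is_moore_penrose_moore_penrose[OF assms(3)],
        folded E_def]
    \<comment> \<open>\<open>S * P = S\<close> with \<open>P\<close> written as
      \<open>S * S\<^sup>\<dagger>\<close>; this yields R(S) = R(SS).\<close>
    have "S * S * S\<^sup>\<dagger> = S"
      using null_space_subset_iff[OF idem(1), of S] P by (simp add: mult.assoc)
    then have "range_space S \<subseteq> range_space (S * S)"
      using range_space_mult_subset[of "S * S" "S\<^sup>\<dagger>"] by simp
    then show "range_space (S * T) = range_space S \<inter> range_space T"
      using \<open>fredholm T\<close> range_space_mult_eq_inter[OF idem(1) _ P(4) E(3) _ _ _ R] E(1)
      unfolding fredholm_def contractive_projection_def by metis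
  qed
  \<comment> \<open>Both products of \<open>T\<close> with its inverse equal \<open>Q\<close>, so
    the conditions with \<open>T * T\<^sup>\<dagger>\<close> and with
    \<open>T\<^sup>\<dagger> * T\<close> coincide.\<close>
  show ?thesis
    using EP_mult_if_null_range_spaces[OF assms] EP_mult_imp_subspaces[OF assms(1,2)]
      range null fredholm
    unfolding P(3)[symmetric] Q(2)[symmetric] Q(3)[symmetric] by blast
qed

end
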